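(* Let $L$ be a finite-dimensional solvable Lie algebra over a field $F$. Let $M, K$ be maximal subalgebras of $L$, and suppose that $K_L \not\subseteq M_L$. Then $M \cap K$ is a maximal subalgebra of $M$.
   Context: For a subalgebra $U$ of $L$, the core $U_L$ is the largest ideal of $L$ contained in $U$. *)

theory Defs
  imports Complex_Main
begin

text \<open>A Lie algebra over a field of arbitrary characteristic, with the whole type as carrier. The
  bracket is required to be alternating, which is stronger than skew-symmetric in characteristic 2.\<close>

locale lie_algebra = vector_space scale
  for scale :: "'f::field \<Rightarrow> 'v::ab_group_add \<Rightarrow> 'v" +
  fixes bracket :: "'v \<Rightarrow> 'v \<Rightarrow> 'v"
  assumes linear_bracket_left: "Vector_Spaces.linear scale scale (\<lambda>x. bracket x y)"
    and linear_bracket_right: "Vector_Spaces.linear scale scale (bracket x)"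
    and bracket_self: "bracket x x = 0"
    and jacobi: "bracket x (bracket y z) + bracket y (bracket z x) + bracket z (bracket x y) = 0"
begin

definition finite_dimensional :: bool where
  "finite_dimensional \<longleftrightarrow> (\<exists>B. finite_dimensional_vector_space scale B)"

definition subalgebra :: "'v set \<Rightarrow> bool" where
  "subalgebra U \<longleftrightarrow> subspace U \<and> (\<forall>x\<in>U. \<forall>y\<in>U. bracket x y \<in> U)"

text \<open>By anticommutativity one-sided closure suffices.\<close>

definition lie_ideal :: "'v set \<Rightarrow> bool" where
  "lie_ideal I \<longleftrightarrow> subspace I \<and> (\<forall>x. \<forall>y\<in>I. bracket x y \<in> I)"

definition maximal_subalgebra :: "'v set \<Rightarrow> 'v set \<Rightarrow> bool" where
  "maximal_subalgebra A U \<longleftrightarrow> subalgebra U \<and> U \<subset> A \<and>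
     (\<forall>H. subalgebra H \<and> U \<subseteq> H \<and> H \<subseteq> A \<longrightarrow> H = U \<or> H = A)"

text \<open>The maximum exists whenever \<open>U\<close> is a subalgebra; see \<open>core_greatest\<close> below.\<close>

definition core :: "'v set \<Rightarrow> 'v set" where
  "core U = (GREATEST I. lie_ideal I \<and> I \<subseteq> U)"

primrec derived_series :: "nat \<Rightarrow> 'v set" where
  "derived_series 0 = UNIV"
| "derived_series (Suc n) =
     span {bracket x y | x y. x \<in> derived_series n \<and> y \<in> derived_series n}"

definition solvable :: bool where
  "solvable \<longleftrightarrow> (\<exists>n. derived_series n = {0})"

lemma lie_ideal_span_Union:
  assumes "\<And>I. I \<in> \<I> \<Longrightarrow> lie_ideal I"
  shows "lie_ideal (span (\<Union>\<I>))"
  unfolding lie_ideal_def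
proof (intro conjI allI ballI)
  show "subspace (span (\<Union>\<I>))" by (rule subspace_span)
next
  fix x y assume "y \<in> span (\<Union>\<I>)"
  moreover have "subspace {y. bracket x y \<in> span (\<Union>\<I>)}"
  proof -
    interpret b: Vector_Spaces.linear scale scale "bracket x" by (rule linear_bracket_right)
    show ?thesis
      by (auto simp: subspace_def b.add b.scale b.zero intro: span_add span_scale span_zero)
  qed
  moreover have "bracket x z \<in> span (\<Union>\<I>)" if "z \<in> \<Union>\<I>" for z
    using that assms by (auto simp: lie_ideal_def intro!: span_base)
  ultimately show "bracket x y \<in> span (\<Union>\<I>)"
    using span_induct[of y "\<Union>\<I>" "\<lambda>y. bracket x y \<in> span (\<Union>\<I>)"] by blast
qed

lemma core_greatest:
  assumes "subalgebra U"
  shows "lie_ideal (core U)" and "core U \<subseteq> U"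
    and "\<And>I. lie_ideal I \<Longrightarrow> I \<subseteq> U \<Longrightarrow> I \<subseteq> core U"
proof -
  let ?S = "span (\<Union>{I. lie_ideal I \<and> I \<subseteq> U})"
  have "lie_ideal ?S" by (rule lie_ideal_span_Union) auto
  moreover have "?S \<subseteq> U"
    using assms by (intro span_minimal) (auto simp: subalgebra_def)
  moreover have upper: "I \<subseteq> ?S" if "lie_ideal I" "I \<subseteq> U" for I
    using that by (auto intro!: span_base)
  ultimately have "core U = ?S"
    unfolding core_def by (intro Greatest_equality) auto
  with \<open>lie_ideal ?S\<close> \<open>?S \<subseteq> U\<close> upper show "lie_ideal (core U)" "core U \<subseteq> U"
    "\<And>I. lie_ideal I \<Longrightarrow> I \<subseteq> U \<Longrightarrow> I \<subseteq> core U" by auto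
qed

end

end

theory Submission
  imports Defs
begin

text \<open>
  Let \<open>I\<close> be the core of \<open>K\<close>. As \<open>I\<close> is an ideal not contained in the core of \<open>M\<close>, it is not
  contained in \<open>M\<close>, so the subalgebra \<open>M + I\<close> is strictly larger than \<open>M\<close> and hence everything.
  By the second isomorphism theorem \<open>M / (M \<inter> I) \<cong> L / I\<close>, and since \<open>I \<subseteq> K\<close> this isomorphism
  matches \<open>(M \<inter> K) / (M \<inter> I)\<close> with the maximal subalgebra \<open>K / I\<close>.

  Quotients are avoided by writing the correspondence out: a subalgebra \<open>H\<close> between \<open>M \<inter> K\<close>
  and \<open>M\<close> is sent to \<open>H + I\<close>, which lies above \<open>(M \<inter> K) + I = K\<close>, and is recovered as
  \<open>M \<inter> (H + I) = H + (M \<inter> I) = H\<close>. Both equalities are instances of the modular law.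
\<close>

context lie_algebra
begin

lemma bracket_add_left: "bracket (x + y) z = bracket x z + bracket y z"
  using linear_bracket_left[of z] unfolding Vector_Spaces.linear_iff by blast

lemma bracket_add_right: "bracket x (y + z) = bracket x y + bracket x z"
  using linear_bracket_right[of x] unfolding Vector_Spaces.linear_iff by blast

text \<open>Expanding \<open>[x + y, x + y] = 0\<close>.\<close>

lemma bracket_anticommute: "bracket x y = - bracket y x"
proof -
  have "bracket x y + bracket y x = bracket (x + y) (x + y)"
    unfolding bracket_add_left bracket_add_right by (simp add: bracket_self)
  then show ?thesis by (simp only: bracket_self eq_neg_iff_add_eq_0)
qed

lemma lie_ideal_bracket_left:
  assumes "lie_ideal I" "x \<in> I"
  shows "bracket x y \<in> I"
  using assms subspace_neg[of I "bracket y x"]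
  by (simp add: bracket_anticommute[of x y] lie_ideal_def)

text \<open>In \<open>[h + i, h' + i'] = [h, h'] + ([h, i'] + [i, h' + i'])\<close> the first summand stays in \<open>H\<close>, the
  others are absorbed by the ideal.\<close>

lemma subalgebra_sum_ideal:
  assumes "subalgebra H" "lie_ideal I"
  shows "subalgebra {h + i | h i. h \<in> H \<and> i \<in> I}"
  unfolding subalgebra_def
proof (intro conjI ballI)
  have sub: "subspace H" "subspace I"
    using assms by (auto simp: subalgebra_def lie_ideal_def)
  then show "subspace {h + i | h i. h \<in> H \<and> i \<in> I}" by (rule subspace_sums)
  fix x y
  assume "x \<in> {h + i | h i. h \<in> H \<and> i \<in> I}" "y \<in> {h + i | h i. h \<in> H \<and> i \<in> I}"
  then obtain h i h' i' where x: "x = h + i" "h \<in> H" "i \<in> I" and y: "y = h' + i'" "h' \<in> H" "i' \<in> I"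
    by blast
  have "bracket x y = bracket h h' + (bracket h i' + bracket i y)"
    by (simp add: x(1) y(1) bracket_add_left bracket_add_right add.assoc)
  moreover have "bracket h h' \<in> H"
    using assms(1) x y by (auto simp: subalgebra_def)
  moreover have "bracket h i' + bracket i y \<in> I"
    using assms(2) y(3) lie_ideal_bracket_left[OF assms(2) x(3)] subspace_add[OF sub(2)]
    by (simp add: lie_ideal_def)
  ultimately show "bracket x y \<in> {h + i | h i. h \<in> H \<and> i \<in> I}" by blast
qed

lemma maximal_subalgebraD:
  assumes "maximal_subalgebra A U" "subalgebra H" "U \<subseteq> H" "H \<subseteq> A"
  shows "H = U \<or> H = A"
  using assms unfolding maximal_subalgebra_def by blast

lemma maximal_subalgebra_sum_ideal:
  assumes M: "maximal_subalgebra UNIV M" and I: "lie_ideal I" "\<not> I \<subseteq> M"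
  shows "{m + i | m i. m \<in> M \<and> i \<in> I} = UNIV"
proof -
  let ?S = "{m + i | m i. m \<in> M \<and> i \<in> I}"
  have sub: "subalgebra M" "subspace M" "subspace I"
    using M I by (auto simp: maximal_subalgebra_def subalgebra_def lie_ideal_def)
  have "M \<subseteq> ?S" using subspace_0[OF sub(3)] by force
  have "I \<subseteq> ?S" using subspace_0[OF sub(2)] by force
  have "?S = M \<or> ?S = UNIV"
    by (rule maximal_subalgebraD[OF M subalgebra_sum_ideal[OF sub(1) I(1)] \<open>M \<subseteq> ?S\<close> subset_UNIV])
  then show ?thesis
  proof
    assume "?S = M"
    with \<open>I \<subseteq> ?S\<close> I(2) show ?thesis by simp
  qed
qed

text \<open>The lattice correspondence behind \<open>M / (M \<inter> I) \<cong> L / I\<close>, for maximal subalgebras.\<close>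

lemma maximal_subalgebra_Int:
  assumes M: "subalgebra M" and K: "maximal_subalgebra UNIV K"
    and I: "lie_ideal I" "I \<subseteq> K" and sum: "{m + i | m i. m \<in> M \<and> i \<in> I} = UNIV"
  shows "maximal_subalgebra M (M \<inter> K)"
  unfolding maximal_subalgebra_def
proof (intro conjI allI impI)
  have K': "subalgebra K" "subspace K" and "K \<noteq> UNIV"
    using K by (auto simp: maximal_subalgebra_def subalgebra_def)
  have M': "subspace M" using M by (simp add: subalgebra_def)
  have decomp: "\<exists>m\<in>M. \<exists>i\<in>I. x = m + i" for x
  proof -
    have "x \<in> {m + i | m i. m \<in> M \<and> i \<in> I}" unfolding sum by (rule UNIV_I)
    then show ?thesis by blast
  qed
  show "subalgebra (M \<inter> K)"
    using M K' M' by (auto simp: subalgebra_def intro: subspace_inter)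
  \<comment> \<open>If \<open>M \<subseteq> K\<close>, then \<open>M + I \<subseteq> K\<close> as well.\<close>
  have "\<not> M \<subseteq> K"
  proof
    assume "M \<subseteq> K"
    then have "x \<in> K" for x
      using decomp[of x] I(2) subspace_add[OF K'(2)] by blast
    with \<open>K \<noteq> UNIV\<close> show False by blast
  qed
  then show "M \<inter> K \<subset> M" by blast
  fix H assume "subalgebra H \<and> M \<inter> K \<subseteq> H \<and> H \<subseteq> M"
  then have H: "subalgebra H" "subspace H" "M \<inter> K \<subseteq> H" "H \<subseteq> M"
    by (auto simp: subalgebra_def)
  let ?S = "{h + i | h i. h \<in> H \<and> i \<in> I}"
  have "K \<subseteq> ?S"
  proof
    fix x assume "x \<in> K"
    obtain m i where x: "m \<in> M" "i \<in> I" "x = m + i" using decomp by blast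
    then have "m \<in> K"
      using subspace_diff[OF K'(2) \<open>x \<in> K\<close>, of i] I(2) by auto
    with x H(3) show "x \<in> ?S" by blast
  qed
  have "?S = K \<or> ?S = UNIV"
    by (rule maximal_subalgebraD[OF K subalgebra_sum_ideal[OF H(1) I(1)] \<open>K \<subseteq> ?S\<close> subset_UNIV])
  then show "H = M \<inter> K \<or> H = M"
  proof
    assume S: "?S = K"
    have "0 \<in> I" using I(1) subspace_0 by (auto simp: lie_ideal_def)
    then have "H \<subseteq> ?S" by force
    with S have "H \<subseteq> K" by simp
    with H(3,4) show ?thesis by blast
  next
    assume S: "?S = UNIV"
    have "m \<in> H" if "m \<in> M" for m
    proof -
      obtain h i where m: "h \<in> H" "i \<in> I" "m = h + i"
        using UNIV_I[of m] unfolding S[symmetric] by blast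
      \<comment> \<open>The component of \<open>m\<close> in \<open>I\<close> lies in \<open>M \<inter> I \<subseteq> M \<inter> K \<subseteq> H\<close>.\<close>
      then have "i \<in> M"
        using subspace_diff[OF M' that, of h] H(4) by auto
      with m I(2) H(3) have "i \<in> H" by blast
      with m show ?thesis using subspace_add[OF H(2)] by blast
    qed
    with H(4) show ?thesis by blast
  qed
qed

end

theorem theorem0p6:
  fixes scale :: "'f::field \<Rightarrow> 'v::ab_group_add \<Rightarrow> 'v"
    and bracket :: "'v \<Rightarrow> 'v \<Rightarrow> 'v"
    and M K :: "'v set"
  assumes "lie_algebra scale bracket"
    and "lie_algebra.finite_dimensional scale"
    and "lie_algebra.solvable scale bracket"
    and "lie_algebra.maximal_subalgebra scale bracket UNIV M"
    and "lie_algebra.maximal_subalgebra scale bracket UNIV K"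
    and "\<not> lie_algebra.core scale bracket K \<subseteq> lie_algebra.core scale bracket M"
  shows "lie_algebra.maximal_subalgebra scale bracket M (M \<inter> K)"
proof -
  interpret lie_algebra scale bracket by (rule assms(1))
  have sub: "subalgebra M" "subalgebra K"
    using assms(4,5) by (auto simp: maximal_subalgebra_def)
  note core_K = core_greatest(1,2)[OF sub(2)]
  have "\<not> core K \<subseteq> M"
    using core_greatest(3)[OF sub(1) core_K(1)] assms(6) by blast
  then show ?thesis
    using maximal_subalgebra_Int[OF sub(1) assms(5) core_K]
      maximal_subalgebra_sum_ideal[OF assms(4) core_K(1)] by blast
qed

end
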